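(* Let $\bar v,\bar q,\bar\kappa,\bar\mu>0$ be constants, $\beta(\xi):=\bar q+\xi^2\bar\kappa$ for $\xi\in\mathbb R$, and $$\widetilde A(\xi):=\begin{pmatrix}0&-\beta(\xi)^{1/2}\\-\beta(\xi)^{1/2}&0\end{pmatrix},\qquad \bar B:=\begin{pmatrix}0&0\\0&\bar\mu/\bar v\end{pmatrix}.$$ There exists a smooth, skew-symmetric, real matrix-valued function $\widetilde K=\widetilde K(\xi)\in C^\infty(\mathbb R;\mathbb R^{2\times2})$ which is a compensating matrix function for the triplet $(I,\widetilde A(\xi),\bar B)$. In other words, $$[\widetilde K(\xi)\widetilde A(\xi)]^s+\bar B\ \ge\ \bar\theta\, I>0$$ for some uniform $\bar\theta>0$ independent of $\xi\in\mathbb R$. Moreover, there exists a uniform constant $C>0$ such that $|\widetilde K(\xi)|\le C$ for all $\xi\in\mathbb R$.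
   Context: For a real matrix $M$, $[M]^s:=\tfrac12(M+M^\top)$ denotes its symmetric part; inequalities between symmetric matrices are in the sense of quadratic forms. Definition (compensating matrix function). Let $A_0,A,B\in C^\infty(\mathbb R;\mathbb R^{2\times2})$ be symmetric for all $\xi\in\mathbb R$, with $A_0>0$ positive definite and $B\ge0$ positive semi-definite. A real matrix-valued $K\in C^\infty(\mathbb R;\mathbb R^{2\times2})$ is a compensating matrix function for the triplet $(A_0,A,B)$ if (a) $K(\xi)A_0(\xi)$ is skew-symmetric for all $\xi\in\mathbb R$; and (b) $[K(\xi)A(\xi)]^s+B(\xi)\ge\theta(\xi)I>0$ for all $\xi\in\mathbb R$, $\xi\neq0$, for some $\theta(\xi)>0$. *)

theory Defs
  imports "HOL-Analysis.Analysis"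
begin

definition smooth_curve :: "(real \<Rightarrow> 'a::real_normed_vector) \<Rightarrow> bool"
  where "smooth_curve f \<longleftrightarrow>
    (\<forall>n \<xi>. ((\<lambda>g t. vector_derivative g (at t)) ^^ n) f differentiable (at \<xi>))"

definition symmetric_matrix :: "real^'n^'n \<Rightarrow> bool"
  where "symmetric_matrix M \<longleftrightarrow> transpose M = M"

definition skew_matrix :: "real^'n^'n \<Rightarrow> bool"
  where "skew_matrix M \<longleftrightarrow> transpose M = - M"

definition sym_part :: "real^'n^'n \<Rightarrow> real^'n^'n"
  where "sym_part M = (1/2) *\<^sub>R (M + transpose M)"

(* Comparison of quadratic forms; used for symmetric matrices only. *)
definition matrix_le :: "real^'n^'n \<Rightarrow> real^'n^'n \<Rightarrow> bool"
  where "matrix_le M N \<longleftrightarrow> (\<forall>x. x \<bullet> (M *v x) \<le> x \<bullet> (N *v x))"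

definition positive_definite :: "real^'n^'n \<Rightarrow> bool"
  where "positive_definite M \<longleftrightarrow> (\<forall>x. x \<noteq> 0 \<longrightarrow> 0 < x \<bullet> (M *v x))"

(* The standing assumptions on the triplet (A0, A, B) are part of the definition. *)
definition compensating_matrix_function ::
    "(real \<Rightarrow> real^2^2) \<Rightarrow> (real \<Rightarrow> real^2^2) \<Rightarrow> (real \<Rightarrow> real^2^2) \<Rightarrow> (real \<Rightarrow> real^2^2) \<Rightarrow> bool"
  where "compensating_matrix_function A0 A B K \<longleftrightarrow>
    smooth_curve A0 \<and> smooth_curve A \<and> smooth_curve B \<and>
    (\<forall>\<xi>. symmetric_matrix (A0 \<xi>) \<and> symmetric_matrix (A \<xi>) \<and> symmetric_matrix (B \<xi>)) \<and>
    (\<forall>\<xi>. positive_definite (A0 \<xi>)) \<and>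
    (\<forall>\<xi>. matrix_le 0 (B \<xi>)) \<and>
    smooth_curve K \<and>
    (\<forall>\<xi>. skew_matrix (K \<xi> ** A0 \<xi>)) \<and>
    (\<forall>\<xi>. \<xi> \<noteq> 0 \<longrightarrow>
      (\<exists>\<theta>>0. matrix_le (\<theta> *\<^sub>R mat 1) (sym_part (K \<xi> ** A \<xi>) + B \<xi>)))"

definition beta :: "real \<Rightarrow> real \<Rightarrow> real \<Rightarrow> real"
  where "beta q \<kappa> \<xi> = q + \<xi>\<^sup>2 * \<kappa>"

definition A_tilde :: "real \<Rightarrow> real \<Rightarrow> real \<Rightarrow> real^2^2"
  where "A_tilde q \<kappa> \<xi> =
    vector [vector [0, - sqrt (beta q \<kappa> \<xi>)],
            vector [- sqrt (beta q \<kappa> \<xi>), 0]]"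

definition B_bar :: "real \<Rightarrow> real \<Rightarrow> real^2^2"
  where "B_bar v \<mu> = vector [vector [0, 0], vector [0, \<mu> / v]]"

end

theory Submission
  imports Defs
begin

text \<open>
  Let \<open>J\<close> be the rotation by a right angle and \<open>\<theta> = \<mu> / (2 v)\<close>. Since \<open>A_tilde\<close> is
  \<open>sqrt \<beta>\<close> times a constant symmetric matrix \<open>S\<close> with \<open>J S = diag(1, -1)\<close>, the choice
  \<open>K = \<theta> \<beta>\<^sup>-\<^sup>1\<^sup>/\<^sup>2 J\<close> gives \<open>K A_tilde + B_bar = diag(\<theta>, -\<theta> + 2 \<theta>) = \<theta> I\<close>. It is bounded because
  \<open>\<beta> \<ge> q > 0\<close>. Smoothness holds because the curves \<open>p(\<xi>) \<beta>(\<xi>)\<^sup>a M\<close>, with \<open>p\<close> a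
  polynomial, \<open>a\<close> real and \<open>M\<close> a constant matrix, are closed under differentiation.
\<close>

text \<open>A set closed under differentiation contains every iterated derivative of its members, so
  one differentiation rule for \<open>S\<close> replaces an induction with explicit higher
  derivatives.\<close>

lemma smooth_curveI:
  assumes "f \<in> S"
    and deriv: "\<And>g. g \<in> S \<Longrightarrow> \<exists>g'\<in>S. \<forall>t. (g has_vector_derivative g' t) (at t)"
  shows "smooth_curve f"
proof -
  have step: "(\<lambda>t. vector_derivative g (at t)) \<in> S" if "g \<in> S" for g
  proof -
    obtain g' where "g' \<in> S" and g': "\<And>t. (g has_vector_derivative g' t) (at t)"
      using deriv[OF \<open>g \<in> S\<close>] by blast
    moreover have "(\<lambda>t. vector_derivative g (at t)) = g'"
      using vector_derivative_at[OF g'] by auto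
    ultimately show ?thesis by simp
  qed
  have iterates: "((\<lambda>g t. vector_derivative g (at t)) ^^ n) f \<in> S" for n
    by (induction n) (auto intro: \<open>f \<in> S\<close> step)
  have "g differentiable (at \<xi>)" if "g \<in> S" for g \<xi>
    using deriv[OF that] by (auto intro: differentiableI_vector)
  then show ?thesis
    unfolding smooth_curve_def using iterates by blast
qed

lemma smooth_curve_const: "smooth_curve (\<lambda>_. c)"
  by (rule smooth_curveI[where S = "range (\<lambda>c _. c)"]) (auto intro!: exI[of _ 0])

lemma beta_ge:
  assumes "\<kappa> \<ge> 0"
  shows "q \<le> beta q \<kappa> \<xi>"
  using assms by (simp add: beta_def)

lemma beta_pos:
  assumes "q > 0" "\<kappa> \<ge> 0"
  shows "beta q \<kappa> \<xi> > 0"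
  using beta_ge[OF assms(2), of q \<xi>] assms(1) by linarith

lemma smooth_curve_beta_powr:
  fixes M :: "'a::real_normed_vector"
  assumes "q > 0" "\<kappa> \<ge> 0"
  shows "smooth_curve (\<lambda>\<xi>. (beta q \<kappa> \<xi> powr a) *\<^sub>R M)"
proof -
  define F where "F p a = (\<lambda>\<xi>. (poly p \<xi> * beta q \<kappa> \<xi> powr a) *\<^sub>R M)" for p a
  let ?b = "[:q, 0, \<kappa>:]"
  \<comment> \<open>Product rule: p' \<beta>^a + a p \<beta>' \<beta>^(a-1), with \<beta>^(a-1)
    factored out. The remaining factor is again a polynomial.\<close>
  have F': "(F p a has_vector_derivative F (pderiv p * ?b + smult a (p * pderiv ?b)) (a - 1) \<xi>) (at \<xi>)"
    for p a \<xi>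
  proof -
    have pos: "beta q \<kappa> \<xi> > 0"
      using beta_pos assms .
    have b: "beta q \<kappa> t = poly ?b t" for t
      by (simp add: beta_def power2_eq_square)
    \<comment> \<open>This splitting brings both terms of the product rule to the exponent
      \<open>a - 1\<close>; it relies on \<beta> being positive.\<close>
    have *: "beta q \<kappa> \<xi> powr a = beta q \<kappa> \<xi> * beta q \<kappa> \<xi> powr (a - 1)"
      using pos by (simp add: powr_mult_base)
    have "((\<lambda>t. poly ?b t powr a) has_real_derivative
        a * poly ?b \<xi> powr (a - of_nat 1) * poly (pderiv ?b) \<xi>) (at \<xi>)"
      using pos unfolding b by (rule DERIV_fun_powr[OF poly_DERIV])
    from DERIV_mult[OF poly_DERIV this]
    have "((\<lambda>t. poly p t * beta q \<kappa> t powr a) has_real_derivative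
        poly (pderiv p * ?b + smult a (p * pderiv ?b)) \<xi> * beta q \<kappa> \<xi> powr (a - 1)) (at \<xi>)"
      unfolding b by (rule DERIV_cong) (simp add: *[unfolded b] algebra_simps del: poly_pCons mult_pCons_right)
    then show ?thesis
      unfolding F_def has_real_derivative_iff_has_vector_derivative
      by (rule bounded_linear.has_vector_derivative[OF bounded_linear_scaleR_left])
  qed
  have "smooth_curve (F 1 a)"
    by (rule smooth_curveI[where S = "{F p a | p a. True}"]) (use F' in blast)+
  then show ?thesis
    by (simp add: F_def)
qed

text \<open>Serves two ends: smoothness becomes an instance of the result on powers of \<beta>, and
  the power cancels against the one in \<open>K\<close>.\<close>

lemma A_tilde_eq:
  assumes "q > 0" "\<kappa> \<ge> 0"
  shows "A_tilde q \<kappa> \<xi> = (beta q \<kappa> \<xi> powr (1/2)) *\<^sub>R vector [vector [0, -1], vector [-1, 0]]"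
  using beta_pos[OF assms, of \<xi>]
  by (simp add: A_tilde_def vec_eq_iff forall_2 powr_half_sqrt)

text \<open>A factor c in place of \<theta> would give diag(c, \<mu>/v - c); the value \<mu>/(2v)
  balances the two entries.\<close>

lemma sym_part_add_B_bar:
  fixes \<mu> v \<xi> :: real
  assumes "q > 0" "\<kappa> \<ge> 0"
  defines "\<theta> \<equiv> \<mu> / (2 * v)"
  defines "K \<equiv> (\<theta> * beta q \<kappa> \<xi> powr (-1/2)) *\<^sub>R vector [vector [0, -1], vector [1, 0]]"
  shows "sym_part (K ** A_tilde q \<kappa> \<xi>) + B_bar v \<mu> = \<theta> *\<^sub>R mat 1"
proof -
  have "beta q \<kappa> \<xi> powr (-1/2) * beta q \<kappa> \<xi> powr (1/2) = 1"
    using beta_pos[OF assms(1,2), of \<xi>] by (simp flip: powr_add)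
  moreover have "\<mu> / v = 2 * \<theta>"
    by (simp add: \<theta>_def)
  ultimately show ?thesis
    unfolding A_tilde_eq[OF assms(1,2)] K_def
    by (simp add: sym_part_def B_bar_def vec_eq_iff forall_2 sum_2 matrix_matrix_mult_def
        transpose_def mat_def mult.commute)
qed

theorem lemma5p1:
  fixes v q \<kappa> \<mu> :: real
  assumes "v > 0" and "q > 0" and "\<kappa> > 0" and "\<mu> > 0"
  shows "\<exists>K :: real \<Rightarrow> real^2^2.
    smooth_curve K \<and>
    (\<forall>\<xi>. skew_matrix (K \<xi>)) \<and>
    compensating_matrix_function (\<lambda>_. mat 1) (A_tilde q \<kappa>) (\<lambda>_. B_bar v \<mu>) K \<and>
    (\<exists>\<theta>>0. \<forall>\<xi>. matrix_le (\<theta> *\<^sub>R mat 1) (sym_part (K \<xi> ** A_tilde q \<kappa> \<xi>) + B_bar v \<mu>)) \<and>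
    (\<exists>C>0. \<forall>\<xi>. norm (K \<xi>) \<le> C)"
proof -
  define \<theta> where "\<theta> = \<mu> / (2 * v)"
  define J :: "real^2^2" where "J = vector [vector [0, -1], vector [1, 0]]"
  define K where "K \<xi> = (\<theta> * beta q \<kappa> \<xi> powr (-1/2)) *\<^sub>R J" for \<xi>
  have "\<theta> > 0" and \<kappa>: "\<kappa> \<ge> 0"
    using assms by (auto simp: \<theta>_def)
  have K_smooth: "smooth_curve K"
    using smooth_curve_beta_powr[OF \<open>q > 0\<close> \<kappa>, of "-1/2" "\<theta> *\<^sub>R J"]
    by (simp add: K_def[abs_def] mult.commute)
  have K_skew: "skew_matrix (K \<xi>)" for \<xi>
    by (simp add: skew_matrix_def K_def J_def vec_eq_iff forall_2 transpose_def)
  have K_le: "matrix_le (\<theta> *\<^sub>R mat 1) (sym_part (K \<xi> ** A_tilde q \<kappa> \<xi>) + B_bar v \<mu>)" for \<xi>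
    using sym_part_add_B_bar[OF \<open>q > 0\<close> \<kappa>, of \<mu> v \<xi>]
    by (simp add: matrix_le_def K_def J_def \<theta>_def)
  have A_smooth: "smooth_curve (A_tilde q \<kappa>)"
    unfolding A_tilde_eq[OF \<open>q > 0\<close> \<kappa>, abs_def]
    by (rule smooth_curve_beta_powr[OF \<open>q > 0\<close> \<kappa>])
  have A_symmetric: "symmetric_matrix (A_tilde q \<kappa> \<xi>)" for \<xi>
    by (simp add: symmetric_matrix_def A_tilde_def vec_eq_iff forall_2 transpose_def)
  have B_symmetric: "symmetric_matrix (B_bar v \<mu>)"
    by (simp add: symmetric_matrix_def B_bar_def vec_eq_iff forall_2 transpose_def)
  \<comment> \<open>The quadratic form is \<mu>/v times the square of the second coordinate; moving
    \<mu> to the front exposes that square.\<close>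
  have B_nonneg: "matrix_le 0 (B_bar v \<mu>)"
    using assms
    by (simp add: matrix_le_def B_bar_def inner_vec_def sum_2 matrix_vector_mult_def
        mult.left_commute[of _ \<mu>])
  \<comment> \<open>With \<open>A0\<close> the identity, condition (a) is skewness of
    \<open>K\<close> itself, and the uniform \<theta> serves at every \<xi>.\<close>
  have "compensating_matrix_function (\<lambda>_. mat 1) (A_tilde q \<kappa>) (\<lambda>_. B_bar v \<mu>) K"
    unfolding compensating_matrix_function_def
    using \<open>\<theta> > 0\<close> K_smooth K_skew K_le A_smooth A_symmetric B_symmetric B_nonneg
    by (auto simp: smooth_curve_const symmetric_matrix_def transpose_mat positive_definite_def)
  \<comment> \<open>The summand 1 makes the bound positive without an argument that \<open>J\<close>
    is nonzero.\<close>
  moreover have "norm (K \<xi>) \<le> \<theta> * q powr (-1/2) * norm J + 1" for \<xi>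
  proof -
    \<comment> \<open>The negative exponent reverses \<beta> \<ge> q.\<close>
    have "beta q \<kappa> \<xi> powr (-1/2) \<le> q powr (-1/2)"
      using \<open>q > 0\<close> beta_ge[OF \<kappa>] by (intro powr_mono2') auto
    then have "\<theta> * beta q \<kappa> \<xi> powr (-1/2) * norm J \<le> \<theta> * q powr (-1/2) * norm J"
      using \<open>\<theta> > 0\<close> by (intro mult_right_mono mult_left_mono) auto
    moreover have "norm (K \<xi>) = \<theta> * beta q \<kappa> \<xi> powr (-1/2) * norm J"
      using \<open>\<theta> > 0\<close> by (simp add: K_def abs_mult)
    ultimately show ?thesis
      by linarith
  qed
  moreover have "\<theta> * q powr (-1/2) * norm J + 1 > 0"
    using \<open>\<theta> > 0\<close> by (intro add_nonneg_pos mult_nonneg_nonneg) auto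
  ultimately show ?thesis
    using \<open>\<theta> > 0\<close> K_smooth K_skew K_le by blast
qed

end
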